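(* Let $R$ and $S$ be finite sets of intervals, let $\epsilon > 0$, and let $S$ be stored in a grid with cells $c_{i,j}$. Let $r \in R$ with $|r| \geq \epsilon$, put $\theta_{start}(r) = r.end - \epsilon$ and $\theta_{end}(r) = r.start + \epsilon$, and let $c_{i,j}$ be a (nonempty) cell such that $\theta_{end}(r) \leq A_{i}^{end,min}[j]$. Put $\theta_{min}(c_{i,j}) = A_{i}^{end,min}[j] - \epsilon$ and $\theta_{max}(c_{i,j}) = A_{i}^{end,max}[j] - \epsilon$. Then for every interval $s \in S$ in the cell $c_{i,j}$: (i) if $s.start \leq r.start$, or if $r.start < s.start \leq \theta_{min}(c_{i,j}) \leq \theta_{start}(r)$, then $(r,s) \in R \bowtie_{\epsilon} S$; (ii) if $\min\{\theta_{max}(c_{i,j}), \theta_{start}(r)\} < s.start$, then $(r,s) \notin R \bowtie_{\epsilon} S$.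
   Context: An interval $r = [r.start, r.end]$ is given by real endpoints $r.start \leq r.end$; its length is $|r| = r.end - r.start$. For intervals $r,s$ the overlap duration is $l(r,s) = \min\{r.end, s.end\} - \max\{r.start, s.start\}$. The interval join is $R \bowtie S = \{(r,s) : r \in R, s \in S, r.start \leq s.end \text{ and } s.start \leq r.end\}$, and the duration-constrained interval join is $R \bowtie_{\epsilon} S = \{(r,s) \in R \bowtie S : l(r,s) \geq \epsilon\}$. Grid: each interval $s$ is viewed as the point $(s.start, s.end)$ in the plane, and $S$ is partitioned by a two-dimensional grid into nonempty cells $c_{i,j}$ (column $i$, $j$-th cell of that column; empty cells are not created). $A_{i}^{end,min}[j]$ and $A_{i}^{end,max}[j]$ denote the minimum and the maximum of $s.end$ over the intervals $s \in S$ in $c_{i,j}$. *)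

theory Defs
  imports "HOL-Analysis.Analysis" "HOL-Library.Interval"
begin

text \<open>
  Intervals are elements of the library type \<open>real interval\<close>, whose elements satisfy
  \<open>lower r \<le> upper r\<close>; \<open>lower\<close>, \<open>upper\<close> and \<open>width\<close> are the start, the end and the length.
\<close>

definition overlap_duration :: "real interval \<Rightarrow> real interval \<Rightarrow> real" where
  "overlap_duration r s = min (upper r) (upper s) - max (lower r) (lower s)"

definition interval_join ::
    "real interval set \<Rightarrow> real interval set \<Rightarrow> (real interval \<times> real interval) set" where
  "interval_join R S =
     {(r, s). r \<in> R \<and> s \<in> S \<and> lower r \<le> upper s \<and> lower s \<le> upper r}"

definition duration_join ::
    "real \<Rightarrow> real interval set \<Rightarrow> real interval set \<Rightarrow> (real interval \<times> real interval) set" where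
  "duration_join \<epsilon> R S = {(r, s) \<in> interval_join R S. overlap_duration r s \<ge> \<epsilon>}"

text \<open>
  A grid is given by a list \<open>Xs\<close> of ranges of start points (the columns, from left to right)
  and, for column \<open>i\<close>, a list \<open>Ys i\<close> of ranges of end points (from bottom to top). A grid whose
  horizontal lines run through all columns is the case of a constant \<open>Ys\<close>. Ranges may be open,
  closed, half-open or unbounded, of equal or unequal width, so no convention is fixed for points
  lying on a grid line.
\<close>

definition consecutive_ranges :: "real set list \<Rightarrow> bool" where
  "consecutive_ranges Xs \<longleftrightarrow>
     (\<forall>X \<in> set Xs. is_interval X) \<and> sorted_wrt (\<lambda>X Y. \<forall>x \<in> X. \<forall>y \<in> Y. x < y) Xs"

definition is_grid :: "real interval set \<Rightarrow> real set list \<Rightarrow> (nat \<Rightarrow> real set list) \<Rightarrow> bool" where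
  "is_grid S Xs Ys \<longleftrightarrow>
     consecutive_ranges Xs \<and>
     (\<forall>i < length Xs. consecutive_ranges (Ys i)) \<and>
     (\<forall>s \<in> S. \<exists>i < length Xs. lower s \<in> Xs ! i \<and> (\<exists>Y \<in> set (Ys i). upper s \<in> Y))"

text \<open>
  Empty cells are dropped before numbering, so \<open>j\<close> counts the nonempty cells of column \<open>i\<close>,
  from \<open>0\<close>. The value \<open>cell S Xs Ys i j\<close> is meaningful only if \<open>is_cell S Xs Ys i j\<close> holds.
\<close>

definition column_cells ::
    "real interval set \<Rightarrow> real set list \<Rightarrow> (nat \<Rightarrow> real set list) \<Rightarrow> nat \<Rightarrow> real interval set list" where
  "column_cells S Xs Ys i =
     filter (\<lambda>c. c \<noteq> {}) (map (\<lambda>Y. {s \<in> S. lower s \<in> Xs ! i \<and> upper s \<in> Y}) (Ys i))"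

definition is_cell ::
    "real interval set \<Rightarrow> real set list \<Rightarrow> (nat \<Rightarrow> real set list) \<Rightarrow> nat \<Rightarrow> nat \<Rightarrow> bool" where
  "is_cell S Xs Ys i j \<longleftrightarrow> i < length Xs \<and> j < length (column_cells S Xs Ys i)"

definition cell ::
    "real interval set \<Rightarrow> real set list \<Rightarrow> (nat \<Rightarrow> real set list) \<Rightarrow> nat \<Rightarrow> nat \<Rightarrow> real interval set" where
  "cell S Xs Ys i j = column_cells S Xs Ys i ! j"

definition end_min :: "real interval set \<Rightarrow> real" where
  "end_min c = Min (upper ` c)"

definition end_max :: "real interval set \<Rightarrow> real" where
  "end_max c = Max (upper ` c)"

definition theta_start :: "real \<Rightarrow> real interval \<Rightarrow> real" where
  "theta_start \<epsilon> r = upper r - \<epsilon>"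

definition theta_end :: "real \<Rightarrow> real interval \<Rightarrow> real" where
  "theta_end \<epsilon> r = lower r + \<epsilon>"

definition theta_min :: "real \<Rightarrow> real interval set \<Rightarrow> real" where
  "theta_min \<epsilon> c = end_min c - \<epsilon>"

definition theta_max :: "real \<Rightarrow> real interval set \<Rightarrow> real" where
  "theta_max \<epsilon> c = end_max c - \<epsilon>"

end

theory Submission
  imports Defs
begin

text \<open>A difference of a minimum and a maximum is at least \<open>\<epsilon>\<close> iff each
  of the two ends exceeds each of the two starts by at least \<open>\<epsilon>\<close>; since
  \<open>\<epsilon> > 0\<close>, this already forces the intervals to meet.
  \<open>duration_join_iff\<close> records these four inequalities. The two that bound
  \<open>lower r\<close> follow from the length of \<open>r\<close> and from
  \<open>theta_end\<close>, so what decides is whether \<open>lower s\<close> is at most both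
  \<open>theta_start \<epsilon> r\<close> and \<open>upper s - \<epsilon>\<close>. The latter lies
  between \<open>theta_min\<close> and \<open>theta_max\<close> of the cell, so comparing
  \<open>lower s\<close> with these cell-wide values can settle the question without
  \<open>upper s\<close>.\<close>

lemma duration_join_iff:
  assumes "\<epsilon> > 0"
  shows "(r, s) \<in> duration_join \<epsilon> R S \<longleftrightarrow>
    r \<in> R \<and> s \<in> S \<and> lower r \<le> upper r - \<epsilon> \<and> lower r \<le> upper s - \<epsilon> \<and>
    lower s \<le> upper r - \<epsilon> \<and> lower s \<le> upper s - \<epsilon>"
  using assms unfolding duration_join_def interval_join_def overlap_duration_def by auto

lemma cell_subset:
  assumes "is_cell S Xs Ys i j"
  shows "cell S Xs Ys i j \<subseteq> S"
proof -
  have "cell S Xs Ys i j \<in> set (column_cells S Xs Ys i)"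
    using assms by (simp add: is_cell_def cell_def)
  then show ?thesis
    by (auto simp: column_cells_def)
qed

theorem theorem2:
  fixes R S :: "real interval set" and \<epsilon> :: real and r :: "real interval"
    and Xs :: "real set list" and Ys :: "nat \<Rightarrow> real set list" and i j :: nat
  assumes "finite R" and "finite S"
    and "\<epsilon> > 0"
    and "is_grid S Xs Ys"
    and "r \<in> R" and "width r \<ge> \<epsilon>"
    and "is_cell S Xs Ys i j"
    and "theta_end \<epsilon> r \<le> end_min (cell S Xs Ys i j)"
  shows "\<forall>s \<in> S. s \<in> cell S Xs Ys i j \<longrightarrow>
      ((lower s \<le> lower r \<or>
        (lower r < lower s \<and> lower s \<le> theta_min \<epsilon> (cell S Xs Ys i j) \<and>
         theta_min \<epsilon> (cell S Xs Ys i j) \<le> theta_start \<epsilon> r)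
        \<longrightarrow> (r, s) \<in> duration_join \<epsilon> R S) \<and>
       (min (theta_max \<epsilon> (cell S Xs Ys i j)) (theta_start \<epsilon> r) < lower s
        \<longrightarrow> (r, s) \<notin> duration_join \<epsilon> R S))"
proof (intro ballI impI)
  fix s assume "s \<in> S" and s: "s \<in> cell S Xs Ys i j"
  \<comment> \<open>Finiteness makes \<open>Min\<close> and \<open>Max\<close> genuine bounds on the
    end points in the cell.\<close>
  have "finite (cell S Xs Ys i j)"
    using cell_subset[OF assms(7)] \<open>finite S\<close> by (rule finite_subset)
  then have "end_min (cell S Xs Ys i j) \<le> upper s" "upper s \<le> end_max (cell S Xs Ys i j)"
    using s by (simp_all add: end_min_def end_max_def)
  moreover have "lower r + \<epsilon> \<le> upper r"
    using \<open>width r \<ge> \<epsilon>\<close> by (simp add: width_def)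
  \<comment> \<open>If \<open>lower s \<le> lower r\<close>, the two bounds on
    \<open>lower r\<close> pass to \<open>lower s\<close>; otherwise they come from
    \<open>theta_min\<close>, which is at most \<open>upper s - \<epsilon>\<close> and, by
    assumption, at most \<open>theta_start\<close>. For rejection, exceeding the minimum means
    exceeding \<open>theta_start\<close> or \<open>theta_max\<close>, and either violates one bound
    on \<open>lower s\<close>.\<close>
  ultimately show "(lower s \<le> lower r \<or>
        (lower r < lower s \<and> lower s \<le> theta_min \<epsilon> (cell S Xs Ys i j) \<and>
         theta_min \<epsilon> (cell S Xs Ys i j) \<le> theta_start \<epsilon> r)
        \<longrightarrow> (r, s) \<in> duration_join \<epsilon> R S) \<and>
       (min (theta_max \<epsilon> (cell S Xs Ys i j)) (theta_start \<epsilon> r) < lower s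
        \<longrightarrow> (r, s) \<notin> duration_join \<epsilon> R S)"
    using assms(8) \<open>r \<in> R\<close> \<open>s \<in> S\<close>
    unfolding duration_join_iff[OF \<open>\<epsilon> > 0\<close>] theta_min_def theta_max_def theta_start_def theta_end_def
    by (auto simp: min_less_iff_disj)
qed

end
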